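(* Let $F:\mathbb{R}^2\to\mathbb{R}$, $F(x,y)=xy$, and let $\varepsilon>0$. The optimal triangle density for piecewise linear $\varepsilon$-underestimations of $F$ is $\frac{3\sqrt3}{16\,\varepsilon}$, and the optimal triangle density for piecewise linear $\varepsilon$-overestimations of $F$ is also $\frac{3\sqrt3}{16\,\varepsilon}$. In both cases the optimal triangles (triangles of maximum area admitting a linear $\varepsilon$-underestimation, respectively $\varepsilon$-overestimation, of $F$) have area $\frac{16\sqrt3}{9}\,\varepsilon$.
   Context: A triangle is the convex hull of three affinely independent points of $\mathbb{R}^2$. A triangulation of $\mathbb{R}^2$ is a countable family $\mathcal T=\{T_i\}_{i\in I}$ of triangles (index set $I\subseteq\mathbb N$) with $\bigcup_i T_i=\mathbb{R}^2$ such that for distinct $i,j$ the set $T_i\cap T_j$ is empty or a common proper face (vertex or edge) of both, and which is locally finite: for every $R>0$ the set $\{x:\|x\|_\infty\le R\}$ meets only finitely many $T_i$. "Linear" means affine. A function $f:\mathbb{R}^2\to\mathbb{R}$ is piecewise linear (pwl) with respect to $\mathcal T$ if there are affine functions $\ell_i$, $i\in I$, with $f(x)=\ell_{i_x}(x)$ for all $x$, where $i_x=\min\{i\in I: x\in T_i\}$; $f$ need not be continuous. It is a pwl $\varepsilon$-underestimation of $F$ if $F-\varepsilon\le f\le F$ on $\mathbb{R}^2$, and a pwl $\varepsilon$-overestimation of $F$ if $F\le f\le F+\varepsilon$ on $\mathbb{R}^2$. The triangle density of $\mathcal T$ is $\delta(\mathcal T)=\limsup_{\ell\to\infty}\frac{|\{T\in\mathcal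 T: T\cap Q_\ell\neq\emptyset\}|}{\ell^2}$, where $Q_\ell$ is the axis-parallel square of side length $\ell$ centered at the origin. The optimal triangle density for $\varepsilon$-underestimations (resp. $\varepsilon$-overestimations) is the infimum of $\delta(\mathcal T)$ over all triangulations $\mathcal T$ of $\mathbb{R}^2$ for which there is a pwl $\varepsilon$-underestimation (resp. $\varepsilon$-overestimation) of $F$ with respect to $\mathcal T$. A triangle $T$ admits a linear $\varepsilon$-underestimation (resp. overestimation) of $F$ if there is an affine $\ell$ with $F-\varepsilon\le\ell\le F$ (resp. $F\le\ell\le F+\varepsilon$) on $T$. *)

theory Defs
  imports "HOL-Analysis.Analysis"
begin

text \<open>
  A triangle is a \<open>2 simplex\<close>, the library's convex hull of three affinely independent points.
  A family \<open>{T i | i \<in> I}\<close> is given by an index set \<open>I :: nat set\<close> and a function \<open>T\<close> on \<open>nat\<close>;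
  the values of \<open>T\<close> outside \<open>I\<close> are irrelevant.
\<close>

definition triangulation :: "nat set \<Rightarrow> (nat \<Rightarrow> (real^2) set) \<Rightarrow> bool" where
  "triangulation I T \<longleftrightarrow>
     (\<forall>i\<in>I. 2 simplex T i) \<and>
     (\<Union>i\<in>I. T i) = UNIV \<and>
     (\<forall>i\<in>I. \<forall>j\<in>I. i \<noteq> j \<longrightarrow>
        T i \<inter> T j = {} \<or>
        (T i \<inter> T j face_of T i \<and> T i \<inter> T j \<noteq> T i \<and>
         T i \<inter> T j face_of T j \<and> T i \<inter> T j \<noteq> T j)) \<and>
     (\<forall>R>0. finite {i \<in> I. T i \<inter> {x. infnorm x \<le> R} \<noteq> {}})"

definition affine_fun :: "(real^2 \<Rightarrow> real) \<Rightarrow> bool" where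
  "affine_fun l \<longleftrightarrow> (\<exists>g c. linear g \<and> l = (\<lambda>x. g x + c))"

definition pwl :: "nat set \<Rightarrow> (nat \<Rightarrow> (real^2) set) \<Rightarrow> (real^2 \<Rightarrow> real) \<Rightarrow> bool" where
  "pwl I T f \<longleftrightarrow>
     (\<exists>l. (\<forall>i\<in>I. affine_fun (l i)) \<and>
          (\<forall>x. f x = l (LEAST i. i \<in> I \<and> x \<in> T i) x))"

definition underestimates_on ::
    "(real^2) set \<Rightarrow> real \<Rightarrow> (real^2 \<Rightarrow> real) \<Rightarrow> (real^2 \<Rightarrow> real) \<Rightarrow> bool" where
  "underestimates_on S \<epsilon> F f \<longleftrightarrow> (\<forall>x\<in>S. F x - \<epsilon> \<le> f x \<and> f x \<le> F x)"

definition overestimates_on ::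
    "(real^2) set \<Rightarrow> real \<Rightarrow> (real^2 \<Rightarrow> real) \<Rightarrow> (real^2 \<Rightarrow> real) \<Rightarrow> bool" where
  "overestimates_on S \<epsilon> F f \<longleftrightarrow> (\<forall>x\<in>S. F x \<le> f x \<and> f x \<le> F x + \<epsilon>)"

text \<open>The axis-parallel square of side length \<open>l\<close> centered at the origin.\<close>

definition centered_square :: "real \<Rightarrow> (real^2) set" where
  "centered_square l = {x. infnorm x \<le> l / 2}"

text \<open>
  In a triangulation distinct indices carry distinct triangles, and only finitely many triangles
  meet a given square, so the cardinality below is the number of triangles meeting it.
  The density may be infinite, hence the type \<^typ>\<open>ereal\<close>.
\<close>

definition triangle_density :: "nat set \<Rightarrow> (nat \<Rightarrow> (real^2) set) \<Rightarrow> ereal" where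
  "triangle_density I T =
     Limsup at_top (\<lambda>l::real.
       ereal (real (card {i \<in> I. T i \<inter> centered_square l \<noteq> {}}) / l\<^sup>2))"

definition optimal_density_under :: "real \<Rightarrow> (real^2 \<Rightarrow> real) \<Rightarrow> ereal" where
  "optimal_density_under \<epsilon> F =
     Inf {triangle_density I T | I T.
            triangulation I T \<and> (\<exists>f. pwl I T f \<and> underestimates_on UNIV \<epsilon> F f)}"

definition optimal_density_over :: "real \<Rightarrow> (real^2 \<Rightarrow> real) \<Rightarrow> ereal" where
  "optimal_density_over \<epsilon> F =
     Inf {triangle_density I T | I T.
            triangulation I T \<and> (\<exists>f. pwl I T f \<and> overestimates_on UNIV \<epsilon> F f)}"

definition optimal_triangle_under :: "real \<Rightarrow> (real^2 \<Rightarrow> real) \<Rightarrow> (real^2) set \<Rightarrow> bool" where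
  "optimal_triangle_under \<epsilon> F =
     is_arg_max (measure lebesgue)
       (\<lambda>T. 2 simplex T \<and> (\<exists>l. affine_fun l \<and> underestimates_on T \<epsilon> F l))"

definition optimal_triangle_over :: "real \<Rightarrow> (real^2 \<Rightarrow> real) \<Rightarrow> (real^2) set \<Rightarrow> bool" where
  "optimal_triangle_over \<epsilon> F =
     is_arg_max (measure lebesgue)
       (\<lambda>T. 2 simplex T \<and> (\<exists>l. affine_fun l \<and> overestimates_on T \<epsilon> F l))"

end

theory Submission
  imports Defs
begin

text \<open>
  Let \<open>l\<close> be an \<open>\<epsilon>\<close>-underestimation of \<open>F\<close> on a triangle and let \<open>q \<in> [0, 1]\<close> be \<open>(F - l) / \<epsilon>\<close>. On a side
  with direction \<open>d\<close>, \<open>q\<close> is a quadratic polynomial with leading coefficient \<open>F d / \<epsilon>\<close>, so \<open>0 \<le> q \<le> 1\<close>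
  bounds \<open>F d / \<epsilon>\<close> above by \<open>(sqrt (q a) + sqrt (q b))\<^sup>2\<close> and below by minus the same expression in \<open>1 - q\<close>,
  where \<open>a\<close>, \<open>b\<close> are the endpoints. The squared area is a Heron-type polynomial in the three values
  \<open>F d\<close>, convex in each of them, so it is maximal at one of the eight corners of the resulting box. The two
  corners of constant sign contribute nothing, as there Heron's formula applies to genuine side lengths;
  the other six are equivalent by symmetry.

  The density is bounded below by comparing areas. The bound is attained by a lattice tiling:
  translates and point reflections of a triangle change \<open>F\<close> only by an affine function, so
  the whole plane can be tiled with copies of one optimal triangle. Subtracting the constant
  \<open>\<epsilon>\<close> turns overestimations into underestimations.
\<close>

section \<open>The area bound\<close>

definition prodform :: "real^2 \<Rightarrow> real" where
  "prodform p = p $ 1 * p $ 2"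

text \<open>
  Heron's formula for the quadratic form \<open>prodform\<close>: if \<open>x\<close>, \<open>y\<close>, \<open>z\<close> are its values on the three sides
  of a triangle, then \<open>heron x y z\<close> is four times the squared area.
\<close>

definition heron :: "real \<Rightarrow> real \<Rightarrow> real \<Rightarrow> real" where
  "heron x y z = x\<^sup>2 + y\<^sup>2 + z\<^sup>2 - 2 * x * y - 2 * y * z - 2 * x * z"

lemma heron_swap12: "heron x y z = heron y x z"
  and heron_swap23: "heron x y z = heron x z y"
  and heron_minus: "heron (- x) (- y) (- z) = heron x y z"
  by (simp_all add: heron_def algebra_simps)

lemma heron_rotate: "heron x y z = heron y z x"
  by (metis heron_swap12 heron_swap23)

lemma heron_divide: "heron (x / e) (y / e) (z / e) = heron x y z / e\<^sup>2"
  by (simp add: heron_def power_divide diff_divide_distrib add_divide_distrib power2_eq_square)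

text \<open>In its first argument \<open>heron\<close> is a quadratic polynomial with leading
  coefficient 1, hence convex. The defect from the chord is exactly
  \<open>(x - a) * (b - x)\<close>, as the displayed identity (scaled by \<open>b - a\<close>)
  shows.\<close>

lemma heron_le_endpoints:
  assumes "a \<le> x" "x \<le> b" "heron a y z \<le> C" "heron b y z \<le> C"
  shows "heron x y z \<le> C"
proof (cases "a = b")
  case True then show ?thesis using assms by simp
next
  case False
  then have ab: "b - a > 0" using assms by simp
  have "(b - a) * heron x y z = (b - x) * heron a y z + (x - a) * heron b y z - (b - a) * ((x - a) * (b - x))"
    by (simp add: heron_def algebra_simps power2_eq_square)
  also have "\<dots> \<le> (b - x) * C + (x - a) * C - 0"
    using assms ab by (intro add_mono diff_mono mult_left_mono) auto
  also have "\<dots> = (b - a) * C" by (simp add: algebra_simps)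
  finally show ?thesis using ab by simp
qed

text \<open>Discriminant argument. The parabola with leading coefficient \<open>Q\<close> and values
  \<open>s^2\<close> at 0 and \<open>r^2\<close> at 1 has discriminant
  \<open>(Q - (s + r)^2) * (Q - (s - r)^2)\<close>. If \<open>Q\<close> exceeded
  \<open>(s + r)^2\<close>, both factors would be positive and the vertex would lie in the unit
  interval, with a negative value there.\<close>

lemma le_square_add_if_interpolation:
  fixes r s Q :: real
  assumes rs: "r \<ge> 0" "s \<ge> 0"
    and le: "\<And>t. 0 \<le> t \<Longrightarrow> t \<le> 1 \<Longrightarrow> t * (1 - t) * Q \<le> (1 - t) * s\<^sup>2 + t * r\<^sup>2"
  shows "Q \<le> (s + r)\<^sup>2"
proof (rule ccontr)
  assume "\<not> ?thesis"
  then have Q: "Q > (s + r)\<^sup>2" by simp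
  have m: "(s - r)\<^sup>2 \<le> (s + r)\<^sup>2" using rs by (simp add: power2_eq_square algebra_simps)
  have Qpos: "Q > 0" using Q by (smt (verit) zero_le_power2)
  define t where "t = (Q + s\<^sup>2 - r\<^sup>2) / (2 * Q)"
  have "s\<^sup>2 - r\<^sup>2 \<le> (s + r)\<^sup>2" "r\<^sup>2 - s\<^sup>2 \<le> (s + r)\<^sup>2"
    using rs by (auto simp: power2_eq_square algebra_simps)
  then have t01: "0 \<le> t" "t \<le> 1" using Q Qpos by (auto simp: t_def field_simps)
  have t: "2 * Q * t = Q + s\<^sup>2 - r\<^sup>2" using Qpos by (simp add: t_def)
  \<comment> \<open>\<open>t\<close> is the vertex of the parabola\<close>
  have "4 * Q * ((1 - t) * s\<^sup>2 + t * r\<^sup>2 - t * (1 - t) * Q)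
      = (2 * Q * t)\<^sup>2 - 2 * (2 * Q * t) * (Q + s\<^sup>2 - r\<^sup>2) + 4 * Q * s\<^sup>2"
    by (simp add: power2_eq_square algebra_simps)
  also have "\<dots> = - ((Q - (s + r)\<^sup>2) * (Q - (s - r)\<^sup>2))"
    unfolding t by (simp add: power2_eq_square algebra_simps)
  also have "\<dots> < 0" using Q m by simp
  finally have "(1 - t) * s\<^sup>2 + t * r\<^sup>2 - t * (1 - t) * Q < 0"
    using Qpos by (simp add: mult_less_0_iff)
  then show False using le[OF t01] by simp
qed

text \<open>The numbers \<open>a + b\<close>, \<open>a + c\<close>, \<open>b + c\<close> are the
  sides of a triangle with tangent lengths \<open>a\<close>, \<open>b\<close>, \<open>c\<close> and
  semiperimeter \<open>a + b + c\<close>. By Heron's formula the value is minus sixteen times its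
  squared area.\<close>

lemma heron_squares_nonpos:
  assumes "a \<ge> 0" "b \<ge> 0" "c \<ge> (0::real)"
  shows "heron ((a + b)\<^sup>2) ((a + c)\<^sup>2) ((b + c)\<^sup>2) \<le> 0"
proof -
  have "heron ((a + b)\<^sup>2) ((a + c)\<^sup>2) ((b + c)\<^sup>2) = - (16 * (a * b * c * (a + b + c)))"
    by (simp add: heron_def power2_eq_square algebra_simps)
  then show ?thesis using assms by simp
qed

text \<open>The essential corner: the two sides at one vertex take their lower bounds, the opposite
  side its upper bound. Here \<open>a\<close> is the square root of \<open>1 - q\<close> at that
  vertex, and the value increases with \<open>a\<close>, so the case \<open>a = 1\<close>
  decides.\<close>

lemma heron_mixed_corner:
  fixes a r1 r2 s1 s2 :: real
  assumes a: "0 \<le> a" "a \<le> 1" and pos: "0 \<le> r1" "0 \<le> r2" "0 \<le> s1" "0 \<le> s2"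
    and one: "r1\<^sup>2 + s1\<^sup>2 = 1" "r2\<^sup>2 + s2\<^sup>2 = 1"
  shows "heron (- ((s1 + a)\<^sup>2)) (- ((s2 + a)\<^sup>2)) ((r1 + r2)\<^sup>2) \<le> 1024 / 27"
proof -
  define S where "S = s1 + s2"
  \<comment> \<open>With \<open>r1\<close>, \<open>r2\<close> as cosines and \<open>s1\<close>,
    \<open>s2\<close> as sines of two angles, \<open>X\<close> and \<open>Y\<close> are 1 plus the
    cosine of the sum and of the difference of the angles. This gives the relation \<open>SY\<close>
    and leaves essentially one variable.\<close>
  define X where "X = 1 + r1 * r2 - s1 * s2"
  define Y where "Y = 1 + r1 * r2 + s1 * s2"
  have le1: "s1 \<le> 1" "s2 \<le> 1" using one pos
    by (smt (verit) zero_le_power2 one_power2 power2_le_imp_le)+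
  have "s1 * s2 \<le> 1" using le1 pos by (simp add: mult_le_one)
  then have X0: "X \<ge> 0" unfolding X_def using pos
    by (smt (verit) mult_nonneg_nonneg)
  have "0 \<le> (r1 - r2)\<^sup>2 + (s1 - s2)\<^sup>2" by simp
  then have Y2: "Y \<le> 2" using one by (simp add: Y_def power2_eq_square algebra_simps)
  have "0 \<le> (r1 - r2)\<^sup>2 + (s1 + s2)\<^sup>2" by simp
  then have X2: "X \<le> 2" using one by (simp add: X_def power2_eq_square algebra_simps)
  have SY: "S\<^sup>2 = (2 - X) * Y"
  proof -
    have "1 - s1\<^sup>2 = r1\<^sup>2" "1 - s2\<^sup>2 = r2\<^sup>2" using one by simp_all
    then have "(1 - s1\<^sup>2) * (1 - s2\<^sup>2) = (r1 * r2)\<^sup>2" by (simp add: power_mult_distrib)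
    then show ?thesis by (simp add: S_def X_def Y_def power2_eq_square algebra_simps)
  qed
  have r: "(r1 + r2)\<^sup>2 = 2 - s1\<^sup>2 - s2\<^sup>2 + 2 * r1 * r2"
    using one by (simp add: power2_sum)
  have "heron (- ((s1 + a)\<^sup>2)) (- ((s2 + a)\<^sup>2)) ((r1 + r2)\<^sup>2)
      = 4 * (X * (Y + 2 * a\<^sup>2 + 2 * a * S))"
    unfolding r by (simp add: heron_def S_def X_def Y_def power2_eq_square algebra_simps)
  also have "\<dots> \<le> 4 * (X * (2 + 2 * 1 + (3 * (2 - X) + 2 / 3)))"
  proof -
    have "a * S \<le> 1 * S" using a pos by (intro mult_right_mono) (auto simp: S_def)
    moreover have "a\<^sup>2 \<le> 1" using a by (simp add: power_le_one)
    \<comment> \<open>equality holds at \<open>s1 = s2 = 1/3\<close>, the optimal triangle\<close>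
    moreover have "0 \<le> (3 * S - 2)\<^sup>2" by simp
    then have "2 * S \<le> 3 / 2 * S\<^sup>2 + 2 / 3" by (simp add: power2_eq_square algebra_simps)
    moreover have "S\<^sup>2 \<le> (2 - X) * 2" unfolding SY using X2 Y2 by (intro mult_left_mono) auto
    ultimately have "Y + 2 * a\<^sup>2 + 2 * a * S \<le> 2 + 2 * 1 + (3 * (2 - X) + 2 / 3)"
      using Y2 by linarith
    then show ?thesis using X0 by (simp add: mult_left_mono)
  qed
  \<comment> \<open>What remains is a concave parabola in \<open>X\<close>; its peak 16/9 is the
    value of \<open>X\<close> at \<open>s1 = s2 = 1/3\<close>.\<close>
  also have "\<dots> = 1024 / 27 - 12 * (X - 16 / 9)\<^sup>2"
    by (simp add: power2_eq_square algebra_simps)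
  also have "\<dots> \<le> 1024 / 27" by simp
  finally show ?thesis .
qed

text \<open>Convexity in each argument moves \<open>Q12\<close>, \<open>Q13\<close>,
  \<open>Q23\<close> one after another to an end of its interval, leaving the eight corners of a
  box. In the application \<open>r\<close> and \<open>s\<close> are the square roots of
  \<open>q\<close> and \<open>1 - q\<close> at the three vertices.\<close>

lemma heron_bound:
  fixes r1 r2 r3 s1 s2 s3 :: real
  assumes pos: "0 \<le> r1" "0 \<le> r2" "0 \<le> r3" "0 \<le> s1" "0 \<le> s2" "0 \<le> s3"
    and one: "r1\<^sup>2 + s1\<^sup>2 = 1" "r2\<^sup>2 + s2\<^sup>2 = 1" "r3\<^sup>2 + s3\<^sup>2 = 1"
    and Q12: "- ((s1 + s2)\<^sup>2) \<le> Q12" "Q12 \<le> (r1 + r2)\<^sup>2"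
    and Q13: "- ((s1 + s3)\<^sup>2) \<le> Q13" "Q13 \<le> (r1 + r3)\<^sup>2"
    and Q23: "- ((s2 + s3)\<^sup>2) \<le> Q23" "Q23 \<le> (r2 + r3)\<^sup>2"
  shows "heron Q12 Q13 Q23 \<le> 1024 / 27"
proof -
  have one': "s1\<^sup>2 + r1\<^sup>2 = 1" "s2\<^sup>2 + r2\<^sup>2 = 1" "s3\<^sup>2 + r3\<^sup>2 = 1"
    using one by simp_all
  have le_1: "r \<le> 1" if "r\<^sup>2 + s\<^sup>2 = 1" for r s :: real
  proof (rule power2_le_imp_le)
    show "r\<^sup>2 \<le> 1\<^sup>2" unfolding one_power2 using that zero_le_power2[of s] by linarith
  qed simp
  note le1 = le_1[OF one(1)] le_1[OF one(2)] le_1[OF one(3)] le_1[OF one'(1)] le_1[OF one'(2)] le_1[OF one'(3)]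
  \<comment> \<open>Negating all arguments preserves \<open>heron\<close>, so two positive sides and
    one negative side reduce to \<open>heron_mixed_corner\<close> with the roles of \<open>r\<close>
    and \<open>s\<close> exchanged.\<close>
  have corner: "heron ((a + s)\<^sup>2) ((a + t)\<^sup>2) (- ((r + u)\<^sup>2)) \<le> 1024 / 27"
    if "0 \<le> a" "a \<le> 1" "0 \<le> r" "0 \<le> u" "0 \<le> s" "0 \<le> t" "r\<^sup>2 + s\<^sup>2 = 1" "u\<^sup>2 + t\<^sup>2 = 1"
    for a r s t u :: real
    using heron_mixed_corner[OF that] heron_minus[of "(a + s)\<^sup>2" "(a + t)\<^sup>2" "- ((r + u)\<^sup>2)"]
    by (simp add: add.commute)
  have corners: "heron (- ((s1 + s2)\<^sup>2)) (- ((s1 + s3)\<^sup>2)) (- ((s2 + s3)\<^sup>2)) \<le> 1024/27"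
    "heron ((r1 + r2)\<^sup>2) ((r1 + r3)\<^sup>2) ((r2 + r3)\<^sup>2) \<le> 1024/27"
    using heron_squares_nonpos[OF pos(1-3)] heron_squares_nonpos[OF pos(4-6)]
    unfolding heron_minus by linarith+
  have pn: "heron (- ((s1 + s2)\<^sup>2)) (- ((s1 + s3)\<^sup>2)) ((r2 + r3)\<^sup>2) \<le> 1024/27"
    "heron (- ((s1 + s2)\<^sup>2)) ((r1 + r3)\<^sup>2) (- ((s2 + s3)\<^sup>2)) \<le> 1024/27"
    "heron ((r1 + r2)\<^sup>2) (- ((s1 + s3)\<^sup>2)) (- ((s2 + s3)\<^sup>2)) \<le> 1024/27"
    using heron_mixed_corner[OF pos(4) le1(4) pos(2,3,5,6) one(2,3)]
      heron_mixed_corner[OF pos(5) le1(5) pos(1,3,4,6) one(1,3)]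
      heron_mixed_corner[OF pos(6) le1(6) pos(1,2,4,5) one(1,2)]
    by (simp_all only: add.commute[of s2 s1] add.commute[of s3] heron_rotate[of "(r1 + r2)\<^sup>2"]
        heron_swap23[of _ "(r1 + r3)\<^sup>2"])
  have np: "heron ((r1 + r2)\<^sup>2) ((r1 + r3)\<^sup>2) (- ((s2 + s3)\<^sup>2)) \<le> 1024/27"
    "heron ((r1 + r2)\<^sup>2) (- ((s1 + s3)\<^sup>2)) ((r2 + r3)\<^sup>2) \<le> 1024/27"
    "heron (- ((s1 + s2)\<^sup>2)) ((r1 + r3)\<^sup>2) ((r2 + r3)\<^sup>2) \<le> 1024/27"
    using corner[OF pos(1) le1(1) pos(5,6,2,3) one'(2,3)]
      corner[OF pos(2) le1(2) pos(4,6,1,3) one'(1,3)]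
      corner[OF pos(3) le1(3) pos(4,5,1,2) one'(1,2)]
    by (simp_all only: add.commute[of r2 r1] add.commute[of r3] heron_rotate[of "- ((s1 + s2)\<^sup>2)"]
        heron_swap23[of _ "- ((s1 + s3)\<^sup>2)"])
  have z: "heron x y Q23 \<le> 1024 / 27"
    if "heron x y (- ((s2 + s3)\<^sup>2)) \<le> 1024 / 27" "heron x y ((r2 + r3)\<^sup>2) \<le> 1024 / 27" for x y
    using heron_le_endpoints[OF Q23, of x y "1024/27"] that by (simp only: heron_rotate[of _ x y])
  have y: "heron x Q13 Q23 \<le> 1024 / 27"
    if "heron x (- ((s1 + s3)\<^sup>2)) Q23 \<le> 1024 / 27" "heron x ((r1 + r3)\<^sup>2) Q23 \<le> 1024 / 27" for x
    using heron_le_endpoints[OF Q13, of x Q23 "1024/27"] that by (simp only: heron_swap12[of _ x])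
  show ?thesis
    by (intro heron_le_endpoints[OF Q12] y z corners pn np)
qed

section \<open>From bounds on the sides to the area of a triangle\<close>

lemma affine_fun_iff:
  "affine_fun l \<longleftrightarrow> (\<exists>A B C. l = (\<lambda>p. A * p $ 1 + B * p $ 2 + C))"
proof
  assume "affine_fun l"
  then obtain g c where g: "linear g" "l = (\<lambda>x. g x + c)" by (auto simp: affine_fun_def)
  define A B where "A = g (axis 1 1)" and "B = g (axis 2 1)"
  have "l p = A * p $ 1 + B * p $ 2 + c" for p
  proof -
    have "p = p $ 1 *\<^sub>R axis 1 1 + p $ 2 *\<^sub>R axis 2 1"
      by (simp add: vec_eq_iff forall_2 axis_def)
    then have "g p = g (p $ 1 *\<^sub>R axis 1 1 + p $ 2 *\<^sub>R axis 2 1)" by (rule arg_cong)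
    also have "\<dots> = A * p $ 1 + B * p $ 2"
      by (simp add: linear_add[OF g(1)] linear_cmul[OF g(1)] A_def B_def)
    finally show ?thesis unfolding g(2) by simp
  qed
  then have "l = (\<lambda>p. A * p $ 1 + B * p $ 2 + c)" by (rule ext)
  then show "\<exists>A B C. l = (\<lambda>p. A * p $ 1 + B * p $ 2 + C)" by (intro exI)
next
  assume "\<exists>A B C. l = (\<lambda>p. A * p $ 1 + B * p $ 2 + C)"
  then obtain A B C where l: "l = (\<lambda>p. A * p $ 1 + B * p $ 2 + C)" by blast
  have "linear (\<lambda>p::real^2. A * p $ 1 + B * p $ 2)"
    by (intro linearI) (auto simp: algebra_simps)
  then show "affine_fun l" unfolding affine_fun_def l by blast
qed

lemma edge_bounds:
  assumes l: "affine_fun l" and T: "convex T" "underestimates_on T \<epsilon> prodform l" "\<epsilon> > 0"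
    and ab: "a \<in> T" "b \<in> T"
  defines "q \<equiv> \<lambda>p. (prodform p - l p) / \<epsilon>"
  shows "- ((sqrt (1 - q a) + sqrt (1 - q b))\<^sup>2) \<le> prodform (a - b) / \<epsilon>"
    and "prodform (a - b) / \<epsilon> \<le> (sqrt (q a) + sqrt (q b))\<^sup>2"
proof -
  have q01: "0 \<le> q p \<and> q p \<le> 1" if "p \<in> T" for p
    using T that by (auto simp: q_def underestimates_on_def field_simps)
  \<comment> \<open>On a segment the affine \<open>l\<close> agrees with its interpolation, while
    the quadratic form falls short of it by exactly
    \<open>t * (1 - t) * prodform (a - b)\<close>.\<close>
  have interp: "q ((1 - t) *\<^sub>R a + t *\<^sub>R b) = (1 - t) * q a + t * q b - t * (1 - t) * (prodform (a - b) / \<epsilon>)" for t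
    using l T(3) unfolding affine_fun_iff q_def
    by (auto simp: prodform_def field_simps)
  have mem: "(1 - t) *\<^sub>R a + t *\<^sub>R b \<in> T" if "0 \<le> t" "t \<le> 1" for t
    using convexD_alt[OF T(1) ab that] .
  show "prodform (a - b) / \<epsilon> \<le> (sqrt (q a) + sqrt (q b))\<^sup>2"
    by (rule le_square_add_if_interpolation)
      (use q01[OF ab(1)] q01[OF ab(2)] q01[OF mem] in \<open>auto simp: interp\<close>)
  \<comment> \<open>The same argument for \<open>1 - q\<close>, which is also nonnegative and has
    the opposite leading coefficient.\<close>
  have "- (prodform (a - b) / \<epsilon>) \<le> (sqrt (1 - q a) + sqrt (1 - q b))\<^sup>2"
  proof (rule le_square_add_if_interpolation)
    fix t :: real assume t: "0 \<le> t" "t \<le> 1"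
    show "t * (1 - t) * - (prodform (a - b) / \<epsilon>) \<le> (1 - t) * (sqrt (1 - q a))\<^sup>2 + t * (sqrt (1 - q b))\<^sup>2"
      using q01[OF ab(1)] q01[OF ab(2)] q01[OF mem[OF t]] unfolding interp
      by (simp add: algebra_simps del: times_divide_eq_right times_divide_eq_left)
  qed (use q01[OF ab(1)] q01[OF ab(2)] in auto)
  then show "- ((sqrt (1 - q a) + sqrt (1 - q b))\<^sup>2) \<le> prodform (a - b) / \<epsilon>" by simp
qed

lemma simplex_2_obtain:
  assumes "2 simplex T"
  obtains a b c where "T = convex hull {a, b, c}" "\<not> affine_dependent {a, b, c}" "card {a, b, c} = 3"
proof -
  obtain C where C: "\<not> affine_dependent C" "int (card C) = 2 + 1" "T = convex hull C"
    using assms by (auto simp: simplex)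
  then have c3: "card C = 3" by simp
  then obtain a b c where "C = {a, b, c}" by (auto simp: card_3_iff)
  then show ?thesis using C c3 that by blast
qed

lemma measure_triangle:
  fixes a b c :: "real^2"
  shows "measure lebesgue (convex hull {a, b, c}) =
    \<bar>(c $ 1 - a $ 1) * (b $ 2 - a $ 2) - (b $ 1 - a $ 1) * (c $ 2 - a $ 2)\<bar> / 2"
proof -
  have "convex hull {a, b, c} \<in> sets lborel"
    by (simp add: compact_convex_hull compact_imp_closed finite_imp_compact)
  then show ?thesis using content_triangle[of a b c] by (simp add: measure_completion)
qed

lemma area_bound:
  assumes T: "2 simplex T" and l: "affine_fun l" "underestimates_on T \<epsilon> prodform l" and "\<epsilon> > 0"
  shows "measure lebesgue T \<le> 16 * sqrt 3 / 9 * \<epsilon>"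
proof -
  obtain a b c where abc: "T = convex hull {a, b, c}" using T by (rule simplex_2_obtain)
  have cv: "convex T" and mem: "a \<in> T" "b \<in> T" "c \<in> T"
    unfolding abc by (auto intro: hull_inc)
  have q01: "0 \<le> (prodform p - l p) / \<epsilon>" "(prodform p - l p) / \<epsilon> \<le> 1" if "p \<in> T" for p
    using l that \<open>\<epsilon> > 0\<close> by (auto simp: underestimates_on_def field_simps)
  note e = edge_bounds[OF l(1) cv l(2) \<open>\<epsilon> > 0\<close>]
  have "heron (prodform (a - b) / \<epsilon>) (prodform (a - c) / \<epsilon>) (prodform (b - c) / \<epsilon>) \<le> 1024 / 27"
    by (rule heron_bound[OF _ _ _ _ _ _ _ _ _ e e e]) (use mem q01 in auto)
  moreover have "heron (prodform (a - b) / \<epsilon>) (prodform (a - c) / \<epsilon>) (prodform (b - c) / \<epsilon>)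
      = heron (prodform (a - b)) (prodform (a - c)) (prodform (b - c)) / \<epsilon>\<^sup>2"
    by (rule heron_divide)
  \<comment> \<open>A polynomial identity: for this form Heron's expression is the squared
    determinant of two sides, that is, the square of twice the area.\<close>
  moreover have "heron (prodform (a - b)) (prodform (a - c)) (prodform (b - c))
      = ((c $ 1 - a $ 1) * (b $ 2 - a $ 2) - (b $ 1 - a $ 1) * (c $ 2 - a $ 2))\<^sup>2"
    unfolding heron_def prodform_def vector_minus_component by algebra
  then have "heron (prodform (a - b)) (prodform (a - c)) (prodform (b - c)) = (2 * measure lebesgue T)\<^sup>2"
    unfolding abc measure_triangle by simp
  ultimately have "(2 * measure lebesgue T)\<^sup>2 \<le> 1024 / 27 * \<epsilon>\<^sup>2"
    using \<open>\<epsilon> > 0\<close> by (simp add: field_simps)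
  also have "\<dots> = (2 * (16 * sqrt 3 / 9 * \<epsilon>))\<^sup>2" by (simp add: power_mult_distrib field_simps)
  finally have "2 * measure lebesgue T \<le> 2 * (16 * sqrt 3 / 9 * \<epsilon>)"
    by (rule power2_le_imp_le) (use \<open>\<epsilon> > 0\<close> in simp)
  then show ?thesis by linarith
qed

section \<open>The lower bound for the density\<close>

lemma prodform_continuous: "continuous_on S prodform"
  unfolding prodform_def by (intro continuous_intros)

lemma simplex_2_interior: "2 simplex (T :: (real^2) set) \<Longrightarrow> interior T \<noteq> {}"
proof (erule simplex_2_obtain)
  fix a b c :: "real^2"
  assume "T = convex hull {a, b, c}" "\<not> affine_dependent {a, b, c}" "card {a, b, c} = 3"
  then show "interior T \<noteq> {}"
    using interior_convex_hull_eq_empty[of "{a, b, c}"] by simp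
qed

lemma triangulation_face:
  assumes "triangulation I T" "i \<in> I" "j \<in> I" "i \<noteq> j"
  shows "T i \<inter> T j = {} \<or> T i \<inter> T j face_of T i \<and> T i \<inter> T j \<noteq> T i"
proof -
  have "\<forall>i\<in>I. \<forall>j\<in>I. i \<noteq> j \<longrightarrow>
        T i \<inter> T j = {} \<or>
        (T i \<inter> T j face_of T i \<and> T i \<inter> T j \<noteq> T i \<and>
         T i \<inter> T j face_of T j \<and> T i \<inter> T j \<noteq> T j)"
    using assms(1) unfolding triangulation_def by (elim conjE)
  from bspec[OF bspec[OF this assms(2)] assms(3)] show ?thesis using assms(4) by argo
qed

text \<open>On the boundary of \<open>T i\<close> the least-index rule may select a piece of another
  triangle. In the interior it selects \<open>l i\<close>, and by continuity the bounds on
  \<open>l i\<close> pass to the closure, which is all of \<open>T i\<close>.\<close>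

lemma pwl_triangle_area:
  assumes T: "triangulation I T" and f: "pwl I T f" "underestimates_on UNIV \<epsilon> prodform f"
    and "\<epsilon> > 0" and i: "i \<in> I"
  shows "measure lebesgue (T i) \<le> 16 * sqrt 3 / 9 * \<epsilon>"
proof -
  obtain l where l: "\<forall>i\<in>I. affine_fun (l i)"
      and fl: "\<forall>x. f x = l (LEAST i. i \<in> I \<and> x \<in> T i) x"
    using f(1) unfolding pwl_def by (elim exE conjE)
  have sx: "2 simplex T i" using T i by (simp add: triangulation_def)
  have cv: "convex (T i)" using sx by (auto simp: simplex)
  have clo: "closed (T i)" using sx by (rule closed_simplex)
  have li: "affine_fun (l i)" using l i by (rule bspec)
  have least: "(LEAST i. i \<in> I \<and> x \<in> T i) = i" if x: "x \<in> interior (T i)" for x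
  proof (rule Least_equality)
    show "i \<in> I \<and> x \<in> T i" using i x interior_subset by blast
  next
    fix j assume j: "j \<in> I \<and> x \<in> T j"
    have "j = i"
    proof (rule ccontr)
      assume "j \<noteq> i"
      then have "i \<noteq> j" by simp
      have "x \<in> T i \<inter> T j" using x j interior_subset by blast
      then have "T i \<inter> T j face_of T i" "T i \<inter> T j \<noteq> T i"
        using triangulation_face[OF T i conjunct1[OF j] \<open>i \<noteq> j\<close>] by auto
      \<comment> \<open>A proper face misses the interior, so an interior point lies in no other
        triangle.\<close>
      then have "T i \<inter> T j \<inter> interior (T i) = {}" by (rule face_of_disjoint_interior)
      then show False using x \<open>x \<in> T i \<inter> T j\<close> by blast
    qed
    then show "i \<le> j" by simp
  qed
  have "interior (T i) \<subseteq> {x. prodform x - \<epsilon> \<le> l i x \<and> l i x \<le> prodform x}"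
  proof
    fix x assume x: "x \<in> interior (T i)"
    have "f x = l i x" using spec[OF fl, of x] unfolding least[OF x] .
    moreover have "prodform x - \<epsilon> \<le> f x \<and> f x \<le> prodform x"
      using f(2) by (simp add: underestimates_on_def)
    ultimately show "x \<in> {x. prodform x - \<epsilon> \<le> l i x \<and> l i x \<le> prodform x}" by simp
  qed
  moreover have "closed {x. prodform x - \<epsilon> \<le> l i x \<and> l i x \<le> prodform x}"
  proof -
    obtain A B C where "l i = (\<lambda>p. A * p $ 1 + B * p $ 2 + C)"
      using li unfolding affine_fun_iff by (elim exE)
    then have "continuous_on UNIV (l i)"
      by (simp only:) (intro continuous_intros)
    then show ?thesis
      by (intro closed_Collect_conj closed_Collect_le continuous_intros prodform_continuous)
  qed
  ultimately have "closure (interior (T i)) \<subseteq> {x. prodform x - \<epsilon> \<le> l i x \<and> l i x \<le> prodform x}"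
    by (rule closure_minimal)
  moreover have "closure (interior (T i)) = T i"
    using convex_closure_interior[OF cv simplex_2_interior[OF sx]] clo by simp
  ultimately have "underestimates_on (T i) \<epsilon> prodform (l i)"
    unfolding underestimates_on_def by blast
  then show ?thesis by (rule area_bound[OF sx li _ \<open>\<epsilon> > 0\<close>])
qed

lemma centered_square_cbox:
  "centered_square l = cbox (\<chi> i. - l / 2) (\<chi> i. l / 2)"
  by (auto simp: centered_square_def infnorm_2 mem_box_cart forall_2)

lemma measure_centered_square: "l \<ge> 0 \<Longrightarrow> measure lebesgue (centered_square l) = l\<^sup>2"
  by (simp add: centered_square_cbox measure_completion content_cbox_if_cart interval_eq_empty_cart
      UNIV_2 power2_eq_square)

text \<open>The triangles meeting a square cover it, so their number times \<open>A\<close> is at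
  least its area. This holds for every positive side length, hence also in the limit
  superior.\<close>

lemma triangle_density_ge:
  assumes T: "triangulation I T" and area: "\<And>i. i \<in> I \<Longrightarrow> measure lebesgue (T i) \<le> A" and "A > 0"
  shows "ereal (1 / A) \<le> triangle_density I T"
proof -
  have bd: "1 / A \<le> real (card {i \<in> I. T i \<inter> centered_square l \<noteq> {}}) / l\<^sup>2" if l: "l > 0" for l
  proof -
    define J where "J = {i \<in> I. T i \<inter> centered_square l \<noteq> {}}"
    have "finite {i \<in> I. T i \<inter> {x. infnorm x \<le> R} \<noteq> {}}" if "R > 0" for R
      using T that by (simp add: triangulation_def)
    then have fin: "finite J" unfolding J_def centered_square_def using half_gt_zero[OF l] .
    have lm: "T i \<in> lmeasurable" if "i \<in> I" for i
    proof -
      have "2 simplex T i" using T that by (auto simp: triangulation_def)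
      then have "compact (T i)" by (rule compact_simplex)
      then show ?thesis by (rule lmeasurable_compact)
    qed
    have "(\<Union>i\<in>I. T i) = UNIV" using T by (simp add: triangulation_def)
    then have "centered_square l \<subseteq> (\<Union>i\<in>J. T i)" unfolding J_def by blast
    then have "measure lebesgue (centered_square l) \<le> measure lebesgue (\<Union>i\<in>J. T i)"
      by (rule measure_mono_fmeasurable)
        (use fin lm in \<open>auto simp: centered_square_cbox J_def intro!: fmeasurable.finite_UN\<close>)
    also have "\<dots> \<le> (\<Sum>i\<in>J. measure lebesgue (T i))"
      by (rule measure_UNION_le[OF fin]) (use lm in \<open>auto simp: J_def\<close>)
    also have "\<dots> \<le> (\<Sum>i\<in>J. A)" by (rule sum_mono) (use area in \<open>auto simp: J_def\<close>)
    finally have "l\<^sup>2 \<le> card J * A" using l by (simp add: measure_centered_square)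
    then show ?thesis using l \<open>A > 0\<close> unfolding J_def[symmetric] by (simp add: field_simps)
  qed
  show ?thesis unfolding triangle_density_def
    by (rule le_Limsup[OF trivial_limit_at_top_linorder])
      (rule eventually_mono[OF eventually_gt_at_top[of 0]], use bd in simp)
qed

section \<open>Overestimation reduced to underestimation by a constant shift\<close>

lemma overestimates_on_iff_underestimates_on:
  "overestimates_on S \<epsilon> F f \<longleftrightarrow> underestimates_on S \<epsilon> F (\<lambda>x. f x - \<epsilon>)"
  by (auto simp: overestimates_on_def underestimates_on_def algebra_simps)

lemma affine_fun_add_const: "affine_fun l \<Longrightarrow> affine_fun (\<lambda>x. l x + c)"
proof -
  assume "affine_fun l"
  then obtain g d where "linear g" "l = (\<lambda>x. g x + d)" by (auto simp: affine_fun_def)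
  then have "linear g \<and> (\<lambda>x. l x + c) = (\<lambda>x. g x + (d + c))" by (simp add: add.assoc)
  then show "affine_fun (\<lambda>x. l x + c)"
    unfolding affine_fun_def by (intro exI[of _ g] exI[of _ "d + c"])
qed

lemma pwl_add_const:
  assumes "pwl I T f"
  shows "pwl I T (\<lambda>x. f x + c)"
proof -
  obtain l where "\<forall>i\<in>I. affine_fun (l i)"
      and "\<forall>x. f x = l (LEAST i. i \<in> I \<and> x \<in> T i) x"
    using assms unfolding pwl_def by (elim exE conjE)
  then show ?thesis unfolding pwl_def
    by (intro exI[of _ "\<lambda>i x. l i x + c"]) (simp add: affine_fun_add_const)
qed

lemma optimal_density_over_eq_under: "optimal_density_over \<epsilon> F = optimal_density_under \<epsilon> F"
proof -
  have "(\<exists>f. pwl I T f \<and> overestimates_on UNIV \<epsilon> F f) \<longleftrightarrow>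
        (\<exists>f. pwl I T f \<and> underestimates_on UNIV \<epsilon> F f)" for I T
  proof
    assume "\<exists>f. pwl I T f \<and> overestimates_on UNIV \<epsilon> F f"
    then obtain f where "pwl I T f" "underestimates_on UNIV \<epsilon> F (\<lambda>x. f x + - \<epsilon>)"
      by (auto simp: overestimates_on_iff_underestimates_on)
    then show "\<exists>f. pwl I T f \<and> underestimates_on UNIV \<epsilon> F f"
      using pwl_add_const[of I T f "- \<epsilon>"] by blast
  next
    assume "\<exists>f. pwl I T f \<and> underestimates_on UNIV \<epsilon> F f"
    then obtain f where "pwl I T f" "overestimates_on UNIV \<epsilon> F (\<lambda>x. f x + \<epsilon>)"
      by (auto simp: overestimates_on_iff_underestimates_on)
    then show "\<exists>f. pwl I T f \<and> overestimates_on UNIV \<epsilon> F f"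
      using pwl_add_const[of I T f \<epsilon>] by blast
  qed
  then show ?thesis unfolding optimal_density_over_def optimal_density_under_def by simp
qed

lemma optimal_triangle_over_eq_under: "optimal_triangle_over \<epsilon> F = optimal_triangle_under \<epsilon> F"
proof -
  have "(\<exists>l. affine_fun l \<and> overestimates_on T \<epsilon> F l) \<longleftrightarrow>
        (\<exists>l. affine_fun l \<and> underestimates_on T \<epsilon> F l)" for T
  proof
    assume "\<exists>l. affine_fun l \<and> overestimates_on T \<epsilon> F l"
    then obtain l where "affine_fun l" "underestimates_on T \<epsilon> F (\<lambda>x. l x + - \<epsilon>)"
      by (auto simp: overestimates_on_iff_underestimates_on)
    then show "\<exists>l. affine_fun l \<and> underestimates_on T \<epsilon> F l"
      using affine_fun_add_const[of l "- \<epsilon>"] by blast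
  next
    assume "\<exists>l. affine_fun l \<and> underestimates_on T \<epsilon> F l"
    then obtain l where "affine_fun l" "overestimates_on T \<epsilon> F (\<lambda>x. l x + \<epsilon>)"
      by (auto simp: overestimates_on_iff_underestimates_on)
    then show "\<exists>l. affine_fun l \<and> overestimates_on T \<epsilon> F l"
      using affine_fun_add_const[of l \<epsilon>] by blast
  qed
  then show ?thesis unfolding optimal_triangle_over_def optimal_triangle_under_def by simp
qed

section \<open>An optimal tiling\<close>

context
  fixes \<epsilon> :: real
  assumes eps: "\<epsilon> > 0"
begin

text \<open>
  \<open>edge1\<close> and \<open>edge2\<close> are two sides of an optimal triangle. They satisfy
  \<open>prodform edge1 = prodform edge2 = - 16/9 \<epsilon>\<close> and \<open>prodform (edge1 - edge2) = 32/9 \<epsilon>\<close>, the equality case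
  of the area bound. The vectors \<open>coord1\<close>, \<open>coord2\<close> form the dual basis.
\<close>

definition edge1 :: "real^2" where
  "edge1 = vector [4 / 3 * (sqrt 3 + 1), - (2 / 3 * \<epsilon> * (sqrt 3 - 1))]"

definition edge2 :: "real^2" where
  "edge2 = vector [4 / 3 * (sqrt 3 - 1), - (2 / 3 * \<epsilon> * (sqrt 3 + 1))]"

definition coord1 :: "real^2" where
  "coord1 = vector [(sqrt 3 + 3) / 16, (3 - sqrt 3) / (8 * \<epsilon>)]"

definition coord2 :: "real^2" where
  "coord2 = vector [(sqrt 3 - 3) / 16, - ((3 + sqrt 3) / (8 * \<epsilon>))]"

text \<open>Constant along the third side \<open>edge1 - edge2\<close>, so that the level lines of
  the three functionals run parallel to the three sides.\<close>

definition coord3 :: "real^2" where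
  "coord3 = - (coord1 + coord2)"

definition oblique_pt :: "real \<Rightarrow> real \<Rightarrow> real^2" where
  "oblique_pt u v = u *\<^sub>R edge1 + v *\<^sub>R edge2"

lemma sqrt3_mult: "sqrt 3 * (sqrt 3 * x) = 3 * (x::real)"
  by (simp flip: mult.assoc)

lemma inner_oblique_pt: "coord1 \<bullet> oblique_pt u v = u" "coord2 \<bullet> oblique_pt u v = v"
  using eps by (simp_all add: oblique_pt_def coord1_def coord2_def edge1_def edge2_def
      inner_vec_def sum_2 field_simps sqrt3_mult)

lemma oblique_pt_inner: "oblique_pt (coord1 \<bullet> p) (coord2 \<bullet> p) = p"
  using eps by (simp add: oblique_pt_def coord1_def coord2_def edge1_def edge2_def
      inner_vec_def sum_2 vec_eq_iff forall_2 field_simps sqrt3_mult)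

lemma inner_coord3: "coord3 \<bullet> p = - (coord1 \<bullet> p) - coord2 \<bullet> p"
  unfolding coord3_def by (simp only: inner_minus_left inner_add_left)

lemma oblique_pt_eqI: "coord1 \<bullet> p = coord1 \<bullet> q \<Longrightarrow> coord2 \<bullet> p = coord2 \<bullet> q \<Longrightarrow> p = q"
  by (metis oblique_pt_inner)

lemma prodform_oblique_pt: "prodform (oblique_pt u v) = - (16 / 9 * \<epsilon> * (u\<^sup>2 + 4 * u * v + v\<^sup>2))"
  by (simp add: prodform_def oblique_pt_def edge1_def edge2_def field_simps sqrt3_mult power2_eq_square)

text \<open>Used with \<open>s = 1\<close> for translates of the triangle spanned by
  \<open>edge1\<close> and \<open>edge2\<close>, and with \<open>s = -1\<close> for translates of
  its point reflection.\<close>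

definition oblique_triangle :: "real \<Rightarrow> real \<Rightarrow> real \<Rightarrow> (real^2) set" where
  "oblique_triangle u v s = convex hull {oblique_pt u v, oblique_pt (u + s) v, oblique_pt u (v + s)}"

lemma mem_oblique_triangle:
  assumes "s = 1 \<or> s = -1"
  shows "p \<in> oblique_triangle u v s \<longleftrightarrow> 0 \<le> s * (coord1 \<bullet> p - u) \<and> 0 \<le> s * (coord2 \<bullet> p - v) \<and>
      s * (coord1 \<bullet> p - u) + s * (coord2 \<bullet> p - v) \<le> 1"
    (is "_ \<longleftrightarrow> ?R")
proof
  assume "p \<in> oblique_triangle u v s"
  then obtain x y z where xyz: "0 \<le> x" "0 \<le> y" "0 \<le> z" "x + y + z = 1"
      and p: "p = x *\<^sub>R oblique_pt u v + y *\<^sub>R oblique_pt (u + s) v + z *\<^sub>R oblique_pt u (v + s)"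
    unfolding oblique_triangle_def convex_hull_3 by blast
  have "coord1 \<bullet> p = (x + y + z) * u + y * s" "coord2 \<bullet> p = (x + y + z) * v + z * s"
    unfolding p by (simp_all add: inner_add_right inner_oblique_pt algebra_simps)
  then show ?R using assms xyz by auto
next
  assume R: ?R
  define y z where "y = s * (coord1 \<bullet> p - u)" and "z = s * (coord2 \<bullet> p - v)"
  have "p = (1 - y - z) *\<^sub>R oblique_pt u v + y *\<^sub>R oblique_pt (u + s) v + z *\<^sub>R oblique_pt u (v + s)"
    using assms by (intro oblique_pt_eqI) (auto simp: inner_add_right inner_oblique_pt y_def z_def algebra_simps)
  moreover have "0 \<le> 1 - y - z" "0 \<le> y" "0 \<le> z" "1 - y - z + y + z = 1"
    using R by (auto simp: y_def z_def)
  ultimately show "p \<in> oblique_triangle u v s" unfolding oblique_triangle_def convex_hull_3 by blast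
qed

lemma measure_oblique_triangle:
  "s = 1 \<or> s = -1 \<Longrightarrow> measure lebesgue (oblique_triangle u v s) = 16 * sqrt 3 / 9 * \<epsilon>"
proof -
  assume s: "s = 1 \<or> s = -1"
  have "(oblique_pt u (v + s) $ 1 - oblique_pt u v $ 1) * (oblique_pt (u + s) v $ 2 - oblique_pt u v $ 2)
      - (oblique_pt (u + s) v $ 1 - oblique_pt u v $ 1) * (oblique_pt u (v + s) $ 2 - oblique_pt u v $ 2)
      = s\<^sup>2 * (edge2 $ 1 * edge1 $ 2 - edge1 $ 1 * edge2 $ 2)"
    by (simp add: oblique_pt_def algebra_simps power2_eq_square)
  also have "\<dots> = 32 * sqrt 3 / 9 * \<epsilon>"
    using s by (auto simp: edge1_def edge2_def field_simps sqrt3_mult)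
  finally show ?thesis unfolding oblique_triangle_def measure_triangle by (simp only:) (use eps in simp)
qed

lemma simplex_oblique_triangle:
  assumes s: "s = 1 \<or> s = -1"
  shows "2 simplex oblique_triangle u v s"
proof -
  have ne: "oblique_pt u v \<noteq> oblique_pt (u + s) v" "oblique_pt u v \<noteq> oblique_pt u (v + s)"
      "oblique_pt (u + s) v \<noteq> oblique_pt u (v + s)"
    using s by (auto dest!: arg_cong[where f = "\<lambda>p. coord1 \<bullet> p - coord2 \<bullet> p"] simp: inner_oblique_pt)
  \<comment> \<open>Dependent vertices would give an empty interior and hence area zero,
    contradicting the computed area.\<close>
  have "\<not> affine_dependent {oblique_pt u v, oblique_pt (u + s) v, oblique_pt u (v + s)}"
  proof
    assume "affine_dependent {oblique_pt u v, oblique_pt (u + s) v, oblique_pt u (v + s)}"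
    moreover have "card {oblique_pt u v, oblique_pt (u + s) v, oblique_pt u (v + s)} = Suc DIM(real^2)"
      using ne by simp
    ultimately have "interior (oblique_triangle u v s) = {}"
      unfolding oblique_triangle_def using interior_convex_hull_eq_empty by blast
    moreover have "convex (oblique_triangle u v s)" by (simp add: oblique_triangle_def)
    ultimately have "negligible (oblique_triangle u v s)"
      using negligible_convex_interior by blast
    then have "measure lebesgue (oblique_triangle u v s) = 0" by (rule negligible_imp_measure0)
    then show False using measure_oblique_triangle[OF s] eps by simp
  qed
  then show ?thesis unfolding simplex oblique_triangle_def using ne
    by (intro exI[of _ "{oblique_pt u v, oblique_pt (u + s) v, oblique_pt u (v + s)}"]) simp
qed

lemma oblique_triangle_underestimation:
  assumes s: "s = 1 \<or> s = -1"
  shows "\<exists>l. affine_fun l \<and> underestimates_on (oblique_triangle u v s) \<epsilon> prodform l"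
proof (intro exI conjI)
  let ?w = "oblique_pt u v"
  \<comment> \<open>The quadratic parts of \<open>prodform p\<close> and
    \<open>prodform (p - ?w)\<close> cancel, so \<open>?l\<close> is affine. With slope 8/3 the gap
    \<open>prodform - ?l\<close> is 0 at \<open>?w\<close> and at the midpoint of the opposite side,
    and reaches \<open>\<epsilon>\<close> on the other two sides at three quarters of the way from
    \<open>?w\<close>.\<close>
  let ?l = "\<lambda>p. prodform p - prodform (p - ?w) - 8 / 3 * \<epsilon> * s * (coord1 \<bullet> p - u + (coord2 \<bullet> p - v))"
  show "affine_fun ?l"
    unfolding affine_fun_iff
    by (rule exI[of _ "?w $ 2 - 8 / 3 * \<epsilon> * s * (coord1 $ 1 + coord2 $ 1)"],
          rule exI[of _ "?w $ 1 - 8 / 3 * \<epsilon> * s * (coord1 $ 2 + coord2 $ 2)"],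
          rule exI[of _ "- (?w $ 1 * ?w $ 2) + 8 / 3 * \<epsilon> * s * (u + v)"])
       (simp add: prodform_def inner_vec_def sum_2 add_divide_distrib algebra_simps)
  show "underestimates_on (oblique_triangle u v s) \<epsilon> prodform ?l"
    unfolding underestimates_on_def
  proof
    fix p assume p: "p \<in> oblique_triangle u v s"
    define x y where "x = s * (coord1 \<bullet> p - u)" and "y = s * (coord2 \<bullet> p - v)"
    have xy: "0 \<le> x" "0 \<le> y" "x + y \<le> 1" using p unfolding mem_oblique_triangle[OF s] x_def y_def by auto
    have "p - ?w = oblique_pt (s * x) (s * y)"
      using s by (intro oblique_pt_eqI) (auto simp: inner_diff_right inner_oblique_pt x_def y_def)
    then have F: "prodform (p - ?w) = - (16 / 9 * \<epsilon> * (x\<^sup>2 + 4 * x * y + y\<^sup>2))"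
      using s by (auto simp: prodform_oblique_pt)
    have l: "prodform p - ?l p = \<epsilon> * (8 / 3 * (x + y) - 16 / 9 * (x\<^sup>2 + 4 * x * y + y\<^sup>2))"
      unfolding F by (simp add: x_def y_def add_divide_distrib diff_divide_distrib algebra_simps)
    have "0 \<le> 8 / 3 * ((x + y) * (1 - (x + y))) + 8 / 9 * (x - y)\<^sup>2"
      using xy by (intro add_nonneg_nonneg mult_nonneg_nonneg) auto
    also have "\<dots> = 8 / 3 * (x + y) - 16 / 9 * (x\<^sup>2 + 4 * x * y + y\<^sup>2)"
      by (simp add: power2_eq_square field_simps)
    finally have "0 \<le> \<epsilon> * (8 / 3 * (x + y) - 16 / 9 * (x\<^sup>2 + 4 * x * y + y\<^sup>2))"
      using eps by simp
    moreover have "8 / 3 * (x + y) - 16 / 9 * (x\<^sup>2 + 4 * x * y + y\<^sup>2)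
        = 1 - (4 / 3 * (x + y) - 1)\<^sup>2 - 32 / 9 * (x * y)"
      by (simp add: power2_eq_square field_simps)
    then have "8 / 3 * (x + y) - 16 / 9 * (x\<^sup>2 + 4 * x * y + y\<^sup>2) \<le> 1"
      using mult_nonneg_nonneg[OF xy(1,2)] zero_le_power2[of "4 / 3 * (x + y) - 1"] by linarith
    then have "\<epsilon> * (8 / 3 * (x + y) - 16 / 9 * (x\<^sup>2 + 4 * x * y + y\<^sup>2)) \<le> \<epsilon> * 1"
      using eps by (intro mult_left_mono) auto
    ultimately show "prodform p - \<epsilon> \<le> ?l p \<and> ?l p \<le> prodform p" using l by linarith
  qed
qed

section \<open>The edge-to-edge tiling by three families of strips\<close>

definition strip :: "real^2 \<Rightarrow> int \<Rightarrow> (real^2) set" where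
  "strip n a = {p. of_int a \<le> n \<bullet> p \<and> n \<bullet> p \<le> of_int a + 1}"

text \<open>
  With \<open>coord1 + coord2 + coord3 = 0\<close>, the nonempty intersections of three strips with interior are those
  whose index sum is \<open>-1\<close> or \<open>-2\<close>. Cutting a tile by a strip gives a face of the tile, which makes the
  tiling edge-to-edge.
\<close>

definition tile :: "int \<times> int \<times> int \<Rightarrow> (real^2) set" where
  "tile = (\<lambda>(a, b, c). strip coord1 a \<inter> strip coord2 b \<inter> strip coord3 c)"

definition tile_index :: "(int \<times> int \<times> int) set" where
  "tile_index = {(a, b, c). a + b + c = -1 \<or> a + b + c = -2}"

text \<open>The first two strips cut out a parallelogram and the third one halves it along a
  diagonal: index sum -1 gives the half at the corner \<open>(a, b)\<close>, sum -2 the opposite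
  half, whose corner is \<open>(a + 1, b + 1)\<close>.\<close>

lemma tile_eq_oblique_triangle:
  assumes "k \<in> tile_index"
  shows "\<exists>u v s. (s = 1 \<or> s = -1) \<and> tile k = oblique_triangle u v s"
proof -
  obtain a b c where k: "k = (a, b, c)" and abc: "a + b + c = -1 \<or> a + b + c = -2"
    using assms by (auto simp: tile_index_def)
  from abc show ?thesis
  proof
    assume "a + b + c = -1"
    then have c: "real_of_int c = - 1 - of_int a - of_int b" by linarith
    have "tile k = oblique_triangle (of_int a) (of_int b) 1"
      by (auto simp: k tile_def strip_def mem_oblique_triangle inner_coord3 c)
    then show ?thesis by blast
  next
    assume "a + b + c = -2"
    then have c: "real_of_int c = - 2 - of_int a - of_int b" by linarith
    have "tile k = oblique_triangle (of_int a + 1) (of_int b + 1) (-1)"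
      by (auto simp: k tile_def strip_def mem_oblique_triangle inner_coord3 c)
    then show ?thesis by blast
  qed
qed

lemma tile_props:
  assumes "k \<in> tile_index"
  shows "2 simplex tile k" "measure lebesgue (tile k) = 16 * sqrt 3 / 9 * \<epsilon>"
    "\<exists>l. affine_fun l \<and> underestimates_on (tile k) \<epsilon> prodform l"
  using tile_eq_oblique_triangle[OF assms] simplex_oblique_triangle measure_oblique_triangle
    oblique_triangle_underestimation by metis+

lemma tile_cover: "\<exists>k\<in>tile_index. p \<in> tile k"
proof -
  define a b where "a = \<lfloor>coord1 \<bullet> p\<rfloor>" and "b = \<lfloor>coord2 \<bullet> p\<rfloor>"
  have ab: "of_int a \<le> coord1 \<bullet> p" "coord1 \<bullet> p < of_int a + 1" "of_int b \<le> coord2 \<bullet> p" "coord2 \<bullet> p < of_int b + 1"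
    unfolding a_def b_def by linarith+
  \<comment> \<open>The choice of \<open>c\<close> records on which side of the diagonal of its
    parallelogram \<open>p\<close> lies.\<close>
  define c where "c = (if coord1 \<bullet> p + coord2 \<bullet> p \<le> of_int a + of_int b + 1 then - 1 - a - b else - 2 - a - b)"
  have "(a, b, c) \<in> tile_index" by (simp add: tile_index_def c_def)
  moreover have "p \<in> tile (a, b, c)" using ab by (simp add: tile_def strip_def inner_coord3 c_def)
  ultimately show ?thesis by blast
qed

text \<open>An adjacent strip can meet \<open>T\<close> only on a supporting line, a strip further
  away misses \<open>T\<close>, and the strip \<open>a\<close> itself contains it; each intersection
  is a face.\<close>

lemma strip_face:
  assumes "convex T" "T \<subseteq> strip n a"
  shows "T \<inter> strip n a' face_of T"
proof -
  consider "a' = a" | "a' = a + 1" | "a' = a - 1" | "a' \<ge> a + 2" | "a' \<le> a - 2" by linarith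
  then show ?thesis
  proof cases
    case 1 then have "T \<inter> strip n a' = T" using assms by auto
    then show ?thesis using assms(1) by (simp add: face_of_refl)
  next
    case 2
    have "T \<inter> strip n a' = T \<inter> {x. n \<bullet> x = of_int a + 1}"
      using assms(2) by (auto simp: strip_def 2)
    moreover have "T \<inter> {x. n \<bullet> x = of_int a + 1} face_of T"
      by (rule face_of_Int_supporting_hyperplane_le) (use assms in \<open>auto simp: strip_def\<close>)
    ultimately show ?thesis by simp
  next
    case 3
    have "T \<inter> strip n a' = T \<inter> {x. n \<bullet> x = of_int a}"
      using assms(2) by (auto simp: strip_def 3)
    moreover have "T \<inter> {x. n \<bullet> x = of_int a} face_of T"
      by (rule face_of_Int_supporting_hyperplane_ge) (use assms in \<open>auto simp: strip_def\<close>)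
    ultimately show ?thesis by simp
  next
    case 4
    then have "T \<inter> strip n a' = {}" using assms(2) by (force simp: strip_def)
    then show ?thesis by simp
  next
    case 5
    then have "T \<inter> strip n a' = {}" using assms(2) by (force simp: strip_def)
    then show ?thesis by simp
  qed
qed

lemma tile_face:
  assumes "k \<in> tile_index"
  shows "tile k \<inter> tile k' face_of tile k"
proof -
  obtain a b c a' b' c' where k: "k = (a, b, c)" "k' = (a', b', c')" by (metis prod_cases3)
  have cv: "convex (tile k)" using tile_props(1)[OF assms] by (auto simp: simplex)
  have "tile k \<inter> tile k' = tile k \<inter> strip coord1 a' \<inter> (tile k \<inter> strip coord2 b') \<inter> (tile k \<inter> strip coord3 c')"
    by (auto simp: k tile_def)
  moreover have "tile k \<subseteq> strip coord1 a" "tile k \<subseteq> strip coord2 b" "tile k \<subseteq> strip coord3 c"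
    by (auto simp: k tile_def)
  ultimately show ?thesis by (simp only:) (intro face_of_Int strip_face cv)
qed

lemma strip_Int_negligible:
  assumes "n \<noteq> 0" "a \<noteq> a'"
  shows "negligible (strip n a \<inter> strip n a')"
proof -
  have "real_of_int a + 1 \<le> of_int a' \<or> real_of_int a' + 1 \<le> of_int a"
    using assms(2) by linarith
  \<comment> \<open>Two distinct strips share at most the line where the one with the larger index
    begins.\<close>
  then have "strip n a \<inter> strip n a' \<subseteq> {x. n \<bullet> x = of_int (max a a')}"
    by (auto simp: strip_def)
  then show ?thesis using negligible_hyperplane assms(1) negligible_subset by blast
qed

lemma tile_Int_negligible:
  assumes "k \<noteq> k'"
  shows "negligible (tile k \<inter> tile k')"
proof -
  obtain a b c a' b' c' where k: "k = (a, b, c)" "k' = (a', b', c')" by (metis prod_cases3)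
  have ne: "coord1 \<noteq> 0" "coord2 \<noteq> 0" "coord3 \<noteq> 0"
    using inner_oblique_pt[of 1 0] inner_oblique_pt[of 0 1] inner_coord3[of "oblique_pt 1 0"] by auto
  consider "a \<noteq> a'" | "b \<noteq> b'" | "c \<noteq> c'" using assms k by blast
  then show ?thesis
  proof cases
    case 1 show ?thesis
      by (rule negligible_subset[OF strip_Int_negligible[OF ne(1) 1]]) (auto simp: k tile_def)
  next
    case 2 show ?thesis
      by (rule negligible_subset[OF strip_Int_negligible[OF ne(2) 2]]) (auto simp: k tile_def)
  next
    case 3 show ?thesis
      by (rule negligible_subset[OF strip_Int_negligible[OF ne(3) 3]]) (auto simp: k tile_def)
  qed
qed

text \<open>Makes the common faces proper: distinct tiles overlap in a null set, while a tile has
  positive area.\<close>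

lemma tile_Int_neq:
  assumes "k \<in> tile_index" "k \<noteq> k'"
  shows "tile k \<inter> tile k' \<noteq> tile k"
proof
  assume "tile k \<inter> tile k' = tile k"
  then have "measure lebesgue (tile k) = 0"
    using tile_Int_negligible[OF assms(2)] negligible_imp_measure0 by metis
  then show False using tile_props(2)[OF assms(1)] eps by simp
qed

section \<open>Counting tiles and the density of the tiling\<close>

lemma tile_diameter:
  assumes "k \<in> tile_index" "p \<in> tile k" "q \<in> tile k"
  shows "infnorm (p - q) \<le> norm edge1 + norm edge2"
proof -
  obtain a b c where k: "k = (a, b, c)" by (metis prod_cases3)
  have d: "\<bar>coord1 \<bullet> p - coord1 \<bullet> q\<bar> \<le> 1" "\<bar>coord2 \<bullet> p - coord2 \<bullet> q\<bar> \<le> 1"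
    using assms(2,3) by (auto simp: k tile_def strip_def)
  have "p - q = oblique_pt (coord1 \<bullet> p - coord1 \<bullet> q) (coord2 \<bullet> p - coord2 \<bullet> q)"
    by (intro oblique_pt_eqI) (auto simp: inner_diff_right inner_oblique_pt)
  then have "norm (p - q) \<le> norm ((coord1 \<bullet> p - coord1 \<bullet> q) *\<^sub>R edge1) + norm ((coord2 \<bullet> p - coord2 \<bullet> q) *\<^sub>R edge2)"
    by (simp only: oblique_pt_def norm_triangle_ineq)
  also have "\<dots> \<le> 1 * norm edge1 + 1 * norm edge2"
    unfolding norm_scaleR using d by (intro add_mono mult_right_mono) auto
  finally show ?thesis using infnorm_le_norm[of "p - q"] by linarith
qed

text \<open>Packing argument: tiles meeting the square stay inside it after enlarging each side by
  the diameter bound at both ends, and they overlap only in null sets, so their areas add up to at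
  most that of the larger square.\<close>

lemma tile_count:
  assumes l: "l \<ge> 0"
  defines "J \<equiv> {k \<in> tile_index. tile k \<inter> centered_square l \<noteq> {}}"
  shows "finite J" "card J * (16 * sqrt 3 / 9 * \<epsilon>) \<le> (l + 2 * (norm edge1 + norm edge2))\<^sup>2"
proof -
  let ?A = "16 * sqrt 3 / 9 * \<epsilon>" and ?L = "l + 2 * (norm edge1 + norm edge2)"
  have A: "?A > 0" using eps by simp
  \<comment> \<open>Proved first for finite subsets, because the finiteness of \<open>J\<close> is
    itself derived from this bound.\<close>
  have bd: "card K * ?A \<le> ?L\<^sup>2" if K: "K \<subseteq> J" "finite K" for K
  proof -
    have lm: "tile k \<in> lmeasurable" if "k \<in> K" for k
    proof -
      have "k \<in> tile_index" using that K(1) by (auto simp: J_def)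
      then have "2 simplex tile k" by (rule tile_props(1))
      then have "compact (tile k)" by (rule compact_simplex)
      then show ?thesis by (rule lmeasurable_compact)
    qed
    have "card K * ?A = (\<Sum>k\<in>K. ?A)" by simp
    also have "\<dots> = (\<Sum>k\<in>K. measure lebesgue (tile k))"
      by (intro sum.cong refl tile_props(2)[symmetric]) (use K in \<open>auto simp: J_def\<close>)
    also have "\<dots> = measure lebesgue (\<Union>k\<in>K. tile k)"
      by (rule measure_negligible_finite_Union_image[symmetric])
        (use K lm tile_Int_negligible in \<open>auto simp: pairwise_def\<close>)
    also have "\<dots> \<le> measure lebesgue (centered_square ?L)"
    proof (rule measure_mono_fmeasurable)
      show "(\<Union>k\<in>K. tile k) \<subseteq> centered_square ?L"
      proof
        fix p assume "p \<in> (\<Union>k\<in>K. tile k)"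
        then obtain k q where k: "k \<in> tile_index" "p \<in> tile k" "q \<in> tile k" "q \<in> centered_square l"
          using K(1) unfolding J_def by blast
        have "infnorm p \<le> infnorm (p - q) + infnorm q" using infnorm_triangle[of "p - q" q] by simp
        then show "p \<in> centered_square ?L"
          using tile_diameter[OF k(1-3)] k(4) by (simp add: centered_square_def)
      qed
    qed (use lm K in \<open>auto simp: centered_square_cbox\<close>)
    also have "\<dots> = ?L\<^sup>2" by (rule measure_centered_square) (use l in simp)
    finally show ?thesis .
  qed
  show fin: "finite J"
  proof (rule ccontr)
    assume "infinite J"
    then obtain K where K: "K \<subseteq> J" "finite K" "card K = nat \<lceil>?L\<^sup>2 / ?A\<rceil> + 1"
      using infinite_arbitrarily_large by meson
    have "?L\<^sup>2 / ?A < card K" unfolding K(3) by linarith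
    then show False using bd[OF K(1,2)] A by (simp add: field_simps)
  qed
  show "card J * ?A \<le> ?L\<^sup>2" using bd fin by blast
qed

text \<open>Triangulations are indexed by natural numbers, so the triples are encoded by
  \<open>to_nat\<close>.\<close>

definition tiling_index :: "nat set" where
  "tiling_index = to_nat ` tile_index"

definition tiling :: "nat \<Rightarrow> (real^2) set" where
  "tiling i = tile (from_nat i)"

lemma tiling_meet:
  "{i \<in> tiling_index. tiling i \<inter> S \<noteq> {}} = to_nat ` {k \<in> tile_index. tile k \<inter> S \<noteq> {}}"
  by (auto simp: tiling_index_def tiling_def intro!: imageI)

lemma triangulation_tiling: "triangulation tiling_index tiling"
  unfolding triangulation_def
proof (intro conjI ballI allI impI)
  show "(\<Union>i\<in>tiling_index. tiling i) = UNIV"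
    using tile_cover by (auto simp: tiling_index_def tiling_def)
next
  fix R :: real assume "R > 0"
  have "{x. infnorm x \<le> R} = centered_square (2 * R)" by (simp add: centered_square_def)
  then show "finite {i \<in> tiling_index. tiling i \<inter> {x. infnorm x \<le> R} \<noteq> {}}"
    unfolding tiling_meet using tile_count(1)[of "2 * R"] \<open>R > 0\<close> by simp
next
  fix i assume "i \<in> tiling_index"
  then show "2 simplex tiling i" using tile_props(1) by (auto simp: tiling_index_def tiling_def)
next
  fix i j assume "i \<in> tiling_index" "j \<in> tiling_index" "i \<noteq> j"
  then obtain k k' where k: "k \<in> tile_index" "k' \<in> tile_index" "k \<noteq> k'"
      "tiling i = tile k" "tiling j = tile k'"
    by (auto simp: tiling_index_def tiling_def)
  then show "tiling i \<inter> tiling j = {} \<or>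
      tiling i \<inter> tiling j face_of tiling i \<and> tiling i \<inter> tiling j \<noteq> tiling i \<and>
      tiling i \<inter> tiling j face_of tiling j \<and> tiling i \<inter> tiling j \<noteq> tiling j"
    using tile_face[of k k'] tile_face[of k' k] tile_Int_neq[of k k'] tile_Int_neq[of k' k]
    by (simp add: Int_commute)
qed

text \<open>The pieces can be chosen independently on the tiles: whichever tile the least-index rule
  selects at \<open>x\<close> contains \<open>x\<close>, and continuity across sides is not
  demanded.\<close>

lemma tiling_underestimation: "\<exists>f. pwl tiling_index tiling f \<and> underestimates_on UNIV \<epsilon> prodform f"
proof -
  have "\<forall>i\<in>tiling_index. \<exists>l. affine_fun l \<and> underestimates_on (tiling i) \<epsilon> prodform l"
    using tile_props(3) by (auto simp: tiling_index_def tiling_def)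
  then obtain l where l: "\<And>i. i \<in> tiling_index \<Longrightarrow> affine_fun (l i)"
      "\<And>i. i \<in> tiling_index \<Longrightarrow> underestimates_on (tiling i) \<epsilon> prodform (l i)"
    by metis
  define least where "least x = (LEAST i. i \<in> tiling_index \<and> x \<in> tiling i)" for x
  have "least x \<in> tiling_index \<and> x \<in> tiling (least x)" for x
  proof -
    have "\<exists>i. i \<in> tiling_index \<and> x \<in> tiling i"
      using triangulation_tiling unfolding triangulation_def by blast
    then show ?thesis unfolding least_def by (rule LeastI_ex)
  qed
  then have "underestimates_on UNIV \<epsilon> prodform (\<lambda>x. l (least x) x)"
    using l(2) by (simp add: underestimates_on_def)
  moreover have "pwl tiling_index tiling (\<lambda>x. l (least x) x)"
    unfolding pwl_def least_def by (intro exI[of _ l]) (simp add: l(1))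
  ultimately show ?thesis by blast
qed

text \<open>Dividing the packing bound by \<open>l^2\<close> gives
  \<open>(1 + 2 * D / l)^2 / A\<close>; the boundary effect of the enlargement vanishes as
  \<open>l\<close> grows.\<close>

lemma tiling_density: "triangle_density tiling_index tiling \<le> ereal (1 / (16 * sqrt 3 / 9 * \<epsilon>))"
proof -
  define A where "A = 16 * sqrt 3 / 9 * \<epsilon>"
  define D where "D = norm edge1 + norm edge2"
  have A: "A > 0" using eps by (simp add: A_def)
  have "triangle_density tiling_index tiling \<le> Limsup at_top (\<lambda>l::real. ereal ((1 + 2 * D / l)\<^sup>2 / A))"
    unfolding triangle_density_def
  proof (rule Limsup_mono, rule eventually_mono[OF eventually_gt_at_top[of 0]])
    fix l :: real assume l: "l > 0"
    have "card {i \<in> tiling_index. tiling i \<inter> centered_square l \<noteq> {}} =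
        card {k \<in> tile_index. tile k \<inter> centered_square l \<noteq> {}}"
      unfolding tiling_meet by (rule card_image) (auto intro: inj_on_subset[OF inj_to_nat])
    then have "card {i \<in> tiling_index. tiling i \<inter> centered_square l \<noteq> {}} * A \<le> (l + 2 * D)\<^sup>2"
      using tile_count(2)[of l] l by (simp add: A_def D_def)
    moreover have "l + 2 * D = l * (1 + 2 * D / l)" using l by (simp add: field_simps)
    ultimately have "card {i \<in> tiling_index. tiling i \<inter> centered_square l \<noteq> {}} * A \<le> l\<^sup>2 * (1 + 2 * D / l)\<^sup>2"
      by (simp add: power_mult_distrib)
    then have "real (card {i \<in> tiling_index. tiling i \<inter> centered_square l \<noteq> {}}) / l\<^sup>2 \<le> (1 + 2 * D / l)\<^sup>2 / A"
      using l A by (simp add: pos_divide_le_eq pos_le_divide_eq mult.commute)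
    then show "ereal (real (card {i \<in> tiling_index. tiling i \<inter> centered_square l \<noteq> {}}) / l\<^sup>2)
        \<le> ereal ((1 + 2 * D / l)\<^sup>2 / A)" by simp
  qed
  also have "\<dots> = ereal (1 / A)"
  proof (rule lim_imp_Limsup[OF trivial_limit_at_top_linorder])
    have "((\<lambda>l::real. 2 * D / l) \<longlongrightarrow> 0) at_top"
      by (intro tendsto_divide_0[OF tendsto_const] filterlim_at_top_imp_at_infinity filterlim_ident)
    then have "((\<lambda>l::real. (1 + 2 * D / l)\<^sup>2 / A) \<longlongrightarrow> (1 + 0)\<^sup>2 / A) at_top"
      using A by (intro tendsto_intros) auto
    then show "((\<lambda>l::real. ereal ((1 + 2 * D / l)\<^sup>2 / A)) \<longlongrightarrow> ereal (1 / A)) at_top" by simp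
  qed
  finally show ?thesis unfolding A_def .
qed

section \<open>The optimal density and the optimal triangles\<close>

lemma optimal_density_under_prodform:
  "optimal_density_under \<epsilon> prodform = ereal (3 * sqrt 3 / (16 * \<epsilon>))"
proof -
  have A: "1 / (16 * sqrt 3 / 9 * \<epsilon>) = 3 * sqrt 3 / (16 * \<epsilon>)" using eps by (simp add: field_simps)
  show ?thesis unfolding optimal_density_under_def A[symmetric]
  proof (rule antisym)
    show "Inf {triangle_density I T |I T. triangulation I T \<and>
        (\<exists>f. pwl I T f \<and> underestimates_on UNIV \<epsilon> prodform f)} \<le> ereal (1 / (16 * sqrt 3 / 9 * \<epsilon>))"
      using triangulation_tiling tiling_underestimation tiling_density by (intro Inf_lower2) blast+
    show "ereal (1 / (16 * sqrt 3 / 9 * \<epsilon>)) \<le> Inf {triangle_density I T |I T. triangulation I T \<and>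
        (\<exists>f. pwl I T f \<and> underestimates_on UNIV \<epsilon> prodform f)}"
    proof (rule Inf_greatest, clarify)
      fix I T f
      assume "triangulation I T" "pwl I T f" "underestimates_on UNIV \<epsilon> prodform f"
      then show "ereal (1 / (16 * sqrt 3 / 9 * \<epsilon>)) \<le> triangle_density I T"
        by (intro triangle_density_ge pwl_triangle_area) (use eps in auto)
    qed
  qed
qed

lemma optimal_triangle_under_prodform:
  "(\<exists>T. optimal_triangle_under \<epsilon> prodform T) \<and>
   (\<forall>T. optimal_triangle_under \<epsilon> prodform T \<longrightarrow> measure lebesgue T = 16 * sqrt 3 / 9 * \<epsilon>)"
proof -
  let ?P = "\<lambda>T. 2 simplex T \<and> (\<exists>l. affine_fun l \<and> underestimates_on T \<epsilon> prodform l)"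
  have opt: "?P (oblique_triangle 0 0 1)" "measure lebesgue (oblique_triangle 0 0 1) = 16 * sqrt 3 / 9 * \<epsilon>"
    using simplex_oblique_triangle[of 1] measure_oblique_triangle[of 1] oblique_triangle_underestimation[of 1] by auto
  have le: "measure lebesgue T \<le> 16 * sqrt 3 / 9 * \<epsilon>" if "?P T" for T
    using that area_bound eps by blast
  \<comment> \<open>Since \<open>oblique_triangle 0 0 1\<close> attains the upper bound, the
    maximizers are exactly the admissible triangles of that area.\<close>
  have "optimal_triangle_under \<epsilon> prodform T \<longleftrightarrow> ?P T \<and> measure lebesgue T = 16 * sqrt 3 / 9 * \<epsilon>" for T
    unfolding optimal_triangle_under_def is_arg_max_def using le[of T] le opt by (smt (verit))
  then show ?thesis using opt by blast
qed

end

theorem theorem1p2: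
  fixes F :: "real^2 \<Rightarrow> real" and \<epsilon> :: real
  assumes "\<And>p. F p = p $ 1 * p $ 2" and "\<epsilon> > 0"
  shows "optimal_density_under \<epsilon> F = ereal (3 * sqrt 3 / (16 * \<epsilon>)) \<and>
         optimal_density_over \<epsilon> F = ereal (3 * sqrt 3 / (16 * \<epsilon>)) \<and>
         (\<exists>T. optimal_triangle_under \<epsilon> F T) \<and>
         (\<forall>T. optimal_triangle_under \<epsilon> F T \<longrightarrow> measure lebesgue T = 16 * sqrt 3 / 9 * \<epsilon>) \<and>
         (\<exists>T. optimal_triangle_over \<epsilon> F T) \<and>
         (\<forall>T. optimal_triangle_over \<epsilon> F T \<longrightarrow> measure lebesgue T = 16 * sqrt 3 / 9 * \<epsilon>)"
proof -
  have "F = prodform" using assms(1) by (simp add: fun_eq_iff prodform_def)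
  then show ?thesis
    using optimal_density_under_prodform[OF assms(2)] optimal_triangle_under_prodform[OF assms(2)]
    by (simp add: optimal_density_over_eq_under optimal_triangle_over_eq_under)
qed

end
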